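(* Let $t, r, n, k$ be integers with $1 \leq t \leq r$, $n \geq n_{\rm S}(r,t)$ and $k \geq 2$. For all $i \in [k]$, let $\emptyset \neq S_i \subseteq [t,r]$ and $\mathcal{F}_i := \bigcup_{s \in S_i}\binom{[n]}{s}$. Let $\mathcal{A}_1, \dots, \mathcal{A}_k$ be cross-$t$-intersecting families such that $\mathcal{A}_i \subseteq \mathcal{F}_i$ for all $i \in [k]$. Then \[ \sum_{i = 1}^k |\mathcal{A}_i| \leq \max \left\{ \sum_{i = 1}^k \sum_{s \in S_i}\binom{n-t}{s-t}, \sum_{s \in S_1}\binom{n}{s}, \dots, \sum_{s \in S_k}\binom{n}{s} \right\}.\] Moreover, equality holds if and only if one of the following holds: (i) $\sum_{i = 1}^k \sum_{s \in S_i}\binom{n-t}{s-t} > \max\{\sum_{s \in S_i}\binom{n}{s} : i \in [k]\}$ and, for some $t$-subset $T$ of $[n]$, $\mathcal{A}_i = \mathcal{F}_i \langle T \rangle$ for all $i \in [k]$; (ii) $\sum_{i = 1}^k \sum_{s \in S_i}\binom{n-t}{s-t} < \max\{\sum_{s \in S_i}\binom{n}{s} : i \in [k]\}$ and, for some $j \in [k]$ such that $|\mathcal{F}_j| = \max\{|\mathcal{F}_i| : i \in [k]\}$, $\mathcal{A}_j = \mathcal{F}_j$ and $\mathcal{A}_i = \emptyset$ for all $i \in [k] \setminus \{j\}$; (iii) $\sum_{i = 1}^k \sum_{s \in S_i}\binom{n-t}{s-t} = \max\{\sum_{s \in S_i}\binom{n}{s} : i \in [k]\}$, and $\mathcal{A}_1,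 \dots, \mathcal{A}_k$ are as in (i) or (ii).
   Context: For integers $m \le n$, $[m,n] := \{i \in \{1,2,\dots\} : m \le i \le n\}$ and $[n] := [1,n]$. For a set $X$, $\binom{X}{s}$ is the family of $s$-subsets of $X$. For a family $\mathcal{F}$ and a set $T$, $\mathcal{F}\langle T\rangle := \{F \in \mathcal{F} : T \subseteq F\}$. A set $A$ $t$-intersects $B$ if $|A\cap B| \ge t$. Families $\mathcal{A}_1,\dots,\mathcal{A}_k$ are cross-$t$-intersecting if for all distinct $i,j \in [k]$, every set in $\mathcal{A}_i$ $t$-intersects every set in $\mathcal{A}_j$. Define $m(r,t) := \max\{2r, \frac{(r-t)(r-t+5)}{2} + (t-1)\}$ and $n_{\rm S}(r,t) := (r-t+1)\binom{m(r,t)}{t+1} + r$. *)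

theory Defs
  imports Complex_Main "HOL-Library.Ramsey"
begin

definition containing :: "'a set set \<Rightarrow> 'a set \<Rightarrow> 'a set set" where
  "containing F T = {A \<in> F. T \<subseteq> A}"

text \<open>Since \<open>card\<close> of an infinite set is \<open>0\<close>, this is the intended notion for
  finite sets only, which is the only case in which it is used.\<close>

definition t_intersects :: "nat \<Rightarrow> 'a set \<Rightarrow> 'a set \<Rightarrow> bool" where
  "t_intersects t A B \<longleftrightarrow> t \<le> card (A \<inter> B)"

definition cross_t_intersecting :: "nat \<Rightarrow> nat \<Rightarrow> (nat \<Rightarrow> 'a set set) \<Rightarrow> bool" where
  "cross_t_intersecting t k \<A> \<longleftrightarrow>
     (\<forall>i\<in>{1..k}. \<forall>j\<in>{1..k}. i \<noteq> j \<longrightarrow> (\<forall>A\<in>\<A> i. \<forall>B\<in>\<A> j. t_intersects t A B))"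

text \<open>The following two are meant for \<open>1 \<le> t \<le> r\<close>, where no subtraction truncates. The
  division by \<open>2\<close> is exact because \<open>d * (d + 5)\<close> is always even.\<close>

definition m_const :: "nat \<Rightarrow> nat \<Rightarrow> nat" where
  "m_const r t = max (2 * r) ((r - t) * (r - t + 5) div 2 + (t - 1))"

definition n_S :: "nat \<Rightarrow> nat \<Rightarrow> nat" where
  "n_S r t = (r - t + 1) * (m_const r t choose (t + 1)) + r"

definition star_config ::
  "nat \<Rightarrow> nat \<Rightarrow> nat \<Rightarrow> (nat \<Rightarrow> nat set set) \<Rightarrow> (nat \<Rightarrow> nat set set) \<Rightarrow> bool" where
  "star_config n t k \<F> \<A> \<longleftrightarrow>
     (\<exists>T \<in> nsets {1..n} t. \<forall>i\<in>{1..k}. \<A> i = containing (\<F> i) T)"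

definition full_config ::
  "nat \<Rightarrow> (nat \<Rightarrow> nat set set) \<Rightarrow> (nat \<Rightarrow> nat set set) \<Rightarrow> bool" where
  "full_config k \<F> \<A> \<longleftrightarrow>
     (\<exists>j\<in>{1..k}. card (\<F> j) = Max ((\<lambda>i. card (\<F> i)) ` {1..k}) \<and>
        \<A> j = \<F> j \<and> (\<forall>i\<in>{1..k} - {j}. \<A> i = {}))"

end

theory Submission
  imports Defs
begin

text \<open>
  Suppose at least two of the families are nonempty. If some \<open>\<A> i\<close> is not contained in a star,
  then a set \<open>B\<close> in another family contains a \<open>t\<close>-subset \<open>T\<close> of a fixed member of \<open>\<A> i\<close> and
  also a point outside \<open>T\<close> of a member of \<open>\<A> i\<close> that does not contain \<open>T\<close>. As \<open>n\<close> is large, this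
  bounds every other family by the fraction \<open>(r - t) / (r - t + 1)\<close> of its star, whereas
  \<open>\<A> i\<close>, all of whose members meet a fixed set of size at most \<open>r\<close>, is smaller than the fraction
  \<open>1 / (r - t + 1)\<close> of \<open>\<F> i\<close>. A weighted mean of the star sum and \<open>card (\<F> i)\<close> is thus strictly
  larger than the sum of the sizes. If every family is contained in a star, the sum of the sizes is
  at most the star sum, and equality forces full stars, whose centres must coincide.
\<close>

section \<open>Counting sets of a fixed size through prescribed points\<close>

lemma finite_containing [simp]: "finite F \<Longrightarrow> finite (containing F T)"
  by (simp add: containing_def)

lemma card_containing_nsets:
  assumes "finite X" "T \<subseteq> X" "card T \<le> s"
  shows "card (containing (nsets X s) T) = (card X - card T) choose (s - card T)"
proof -
  have fT: "finite T"
    using assms finite_subset by blast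
  have "bij_betw (\<lambda>A. A \<union> T) (nsets (X - T) (s - card T)) (containing (nsets X s) T)"
  proof (rule bij_betw_byWitness[where f' = "\<lambda>A. A - T"])
    show "(\<lambda>A. A \<union> T) ` nsets (X - T) (s - card T) \<subseteq> containing (nsets X s) T"
    proof safe
      fix A assume A: "A \<in> nsets (X - T) (s - card T)"
      then have "card (A \<union> T) = card A + card T"
        using fT by (intro card_Un_disjoint) (auto simp: nsets_def)
      then show "A \<union> T \<in> containing (nsets X s) T"
        using A fT assms by (auto simp: nsets_def containing_def)
    qed
    show "(\<lambda>A. A - T) ` containing (nsets X s) T \<subseteq> nsets (X - T) (s - card T)"
      using fT by (auto simp: nsets_def containing_def card_Diff_subset)
  qed (auto simp: nsets_def containing_def)
  then have "card (containing (nsets X s) T) = card (nsets (X - T) (s - card T))"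
    by (rule bij_betw_same_card[symmetric])
  also have "nsets (X - T) (s - card T) = {B. B \<subseteq> X - T \<and> card B = s - card T}"
    using assms(1) by (auto simp: nsets_def intro: finite_subset)
  also have "card \<dots> = (card X - card T) choose (s - card T)"
    using assms fT by (simp add: n_subsets card_Diff_subset)
  finally show ?thesis .
qed

text \<open>Forcing one more point cuts a star to at most the fraction
  \<open>(s - card T) / (card X - card T)\<close>, by the absorption identity for binomials. If
  \<open>x\<close> lies outside \<open>X\<close>, or \<open>T\<close> already has \<open>s\<close>
  elements, no set qualifies. The inequality is multiplied out to stay within the naturals.\<close>

lemma card_containing_insert_le:
  assumes "finite X" "T \<subseteq> X" "x \<notin> T" "card T \<le> s"
  shows "(card X - card T) * card (containing (nsets X s) (insert x T))
       \<le> (s - card T) * ((card X - card T) choose (s - card T))"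
proof -
  have fT: "finite T"
    using assms finite_subset by blast
  show ?thesis
  proof (cases "x \<in> X \<and> card T < s")
    case True
    then have "card (containing (nsets X s) (insert x T))
             = (card X - card T - 1) choose (s - card T - 1)"
      using assms fT card_containing_nsets[of X "insert x T" s] by simp
    then show ?thesis
      using True binomial_absorption[of "s - card T - 1" "card X - card T"]
      by (simp add: Suc_diff_Suc del: mult_Suc)
  next
    case False
    have "containing (nsets X s) (insert x T) = {}"
    proof (rule ccontr)
      assume "containing (nsets X s) (insert x T) \<noteq> {}"
      then obtain A where A: "A \<subseteq> X" "finite A" "card A = s" "insert x T \<subseteq> A"
        by (auto simp: containing_def nsets_def)
      then have "card (insert x T) \<le> s"
        using card_mono by blast
      then show False
        using A False fT assms(3) by auto
    qed
    then show ?thesis by simp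
  qed
qed

text \<open>Union bound over the points of \<open>B\<close>: by the preceding lemma with empty
  \<open>T\<close>, each point lies in at most the fraction \<open>s / card X\<close> of all
  \<open>s\<close>-subsets.\<close>

lemma card_meeting_le:
  assumes "finite X" "finite B" "C \<subseteq> nsets X s" "\<And>A. A \<in> C \<Longrightarrow> A \<inter> B \<noteq> {}"
  shows "card X * card C \<le> card B * (s * (card X choose s))"
proof -
  let ?D = "\<lambda>x. containing (nsets X s) {x}"
  have fin: "finite (nsets X s)"
    using assms(1) by (rule finite_imp_finite_nsets)
  have "C \<subseteq> (\<Union>x\<in>B. ?D x)"
    using assms(3,4) by (fastforce simp: containing_def)
  then have "card C \<le> card (\<Union>x\<in>B. ?D x)"
    using fin assms(2) by (intro card_mono) auto
  also have "\<dots> \<le> (\<Sum>x\<in>B. card (?D x))"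
    using assms(2) by (rule card_UN_le)
  finally have "card C \<le> (\<Sum>x\<in>B. card (?D x))" .
  then have "card X * card C \<le> (\<Sum>x\<in>B. card X * card (?D x))"
    by (simp flip: sum_distrib_left)
  also have "\<dots> \<le> card B * (s * (card X choose s))"
    using card_containing_insert_le[OF assms(1), of "{}"]
    by (intro sum_bounded_above[where 'a = nat, simplified]) auto
  finally show ?thesis .
qed

text \<open>Every \<open>B\<close> in \<open>C\<close> contains some \<open>t\<close>-subset
  \<open>T\<close> of \<open>D\<^sub>0\<close>. The member \<open>f T\<close> of \<open>\<D>\<close>
  misses part of \<open>T\<close> yet shares \<open>t\<close> points with \<open>B\<close>, so one
  of these lies outside \<open>T\<close>. Hence \<open>B\<close> contains \<open>insert x T\<close>
  for one of at most \<open>(r choose t) * r\<close> pairs \<open>(T, x)\<close>, and the one-point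
  estimate applies to each pair.\<close>

lemma card_cross_nontrivial_le:
  assumes "finite X" and \<D>: "\<And>D. D \<in> \<D> \<Longrightarrow> D \<subseteq> X \<and> card D \<le> r"
    and nontriv: "\<And>T. T \<in> nsets X t \<Longrightarrow> \<exists>D\<in>\<D>. \<not> T \<subseteq> D"
    and "D\<^sub>0 \<in> \<D>" and "C \<subseteq> nsets X s" and "t \<le> s"
    and cross: "\<And>D B. D \<in> \<D> \<Longrightarrow> B \<in> C \<Longrightarrow> t_intersects t D B"
  shows "(card X - t) * card C \<le> (r choose t) * r * ((s - t) * ((card X - t) choose (s - t)))"
proof -
  obtain f where f: "\<And>T. T \<in> nsets X t \<Longrightarrow> f T \<in> \<D> \<and> \<not> T \<subseteq> f T"
    using nontriv by metis
  let ?E = "\<lambda>T x. containing (nsets X s) (insert x T)"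
  have fD: "finite D" if "D \<in> \<D>" for D
    using \<D>[OF that] \<open>finite X\<close> finite_subset by blast
  have sub: "nsets D\<^sub>0 t \<subseteq> nsets X t"
    using \<D> \<open>D\<^sub>0 \<in> \<D>\<close> by (simp add: nsets_mono)
  have finN: "finite (nsets D\<^sub>0 t)"
    using fD \<open>D\<^sub>0 \<in> \<D>\<close> by (simp add: finite_imp_finite_nsets)
  have finE: "finite (?E T x)" for T x
    using \<open>finite X\<close> by (simp add: finite_imp_finite_nsets)
  have cover: "C \<subseteq> (\<Union>T\<in>nsets D\<^sub>0 t. \<Union>x\<in>f T - T. ?E T x)"
  proof
    fix B assume B: "B \<in> C"
    obtain T where T: "T \<subseteq> D\<^sub>0 \<inter> B" "card T = t" "finite T"
      using cross[OF \<open>D\<^sub>0 \<in> \<D>\<close> B] by (auto simp: t_intersects_def elim: obtain_subset_with_card_n)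
    then have TN: "T \<in> nsets D\<^sub>0 t"
      by (auto simp: nsets_def)
    with sub f have fT: "f T \<in> \<D>" "\<not> T \<subseteq> f T"
      by auto
    have "\<not> f T \<inter> B \<subseteq> T"
    proof
      assume "f T \<inter> B \<subseteq> T"
      then have "f T \<inter> B \<subset> T"
        using fT by blast
      then have "card (f T \<inter> B) < t"
        using T psubset_card_mono by blast
      then show False
        using cross[OF fT(1) B] by (simp add: t_intersects_def)
    qed
    then obtain x where "x \<in> f T - T" "x \<in> B"
      by blast
    then show "B \<in> (\<Union>T\<in>nsets D\<^sub>0 t. \<Union>x\<in>f T - T. ?E T x)"
      using TN T B assms(5) by (auto simp: containing_def intro!: bexI[of _ T] bexI[of _ x])
  qed
  let ?K = "(s - t) * ((card X - t) choose (s - t))"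
  have inner: "(card X - t) * card (\<Union>x\<in>f T - T. ?E T x) \<le> r * ?K" if "T \<in> nsets D\<^sub>0 t" for T
  proof -
    have T: "T \<subseteq> X" "card T = t" "f T \<in> \<D>"
      using that sub f by (auto simp: nsets_def)
    have "card (\<Union>x\<in>f T - T. ?E T x) \<le> (\<Sum>x\<in>f T - T. card (?E T x))"
      using fD T by (intro card_UN_le) auto
    then have "(card X - t) * card (\<Union>x\<in>f T - T. ?E T x)
             \<le> (\<Sum>x\<in>f T - T. (card X - t) * card (?E T x))"
      by (simp flip: sum_distrib_left)
    also have "\<dots> \<le> card (f T - T) * ?K"
      using card_containing_insert_le[OF \<open>finite X\<close> T(1)] T(2) \<open>t \<le> s\<close>
      by (intro sum_bounded_above[where 'a = nat, simplified]) auto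
    also have "\<dots> \<le> r * ?K"
      using \<D>[OF T(3)] fD[OF T(3)] card_mono[of "f T" "f T - T"]
      by (intro mult_right_mono) auto
    finally show ?thesis .
  qed
  have "card C \<le> card (\<Union>T\<in>nsets D\<^sub>0 t. \<Union>x\<in>f T - T. ?E T x)"
    using finN fD sub f finE by (intro card_mono cover finite_UN_I) auto
  also have "\<dots> \<le> (\<Sum>T\<in>nsets D\<^sub>0 t. card (\<Union>x\<in>f T - T. ?E T x))"
    using finN by (rule card_UN_le)
  finally have "(card X - t) * card C
      \<le> (\<Sum>T\<in>nsets D\<^sub>0 t. (card X - t) * card (\<Union>x\<in>f T - T. ?E T x))"
    by (simp flip: sum_distrib_left)
  also have "\<dots> \<le> card (nsets D\<^sub>0 t) * (r * ?K)"
    using inner by (intro sum_bounded_above[where 'a = nat, simplified]) auto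
  \<comment> \<open>Containing the empty set is no restriction, so the star count at
    \<open>{}\<close> counts all \<open>t\<close>-subsets.\<close>
  also have "card (nsets D\<^sub>0 t) = card D\<^sub>0 choose t"
    using card_containing_nsets[OF fD[OF \<open>D\<^sub>0 \<in> \<D>\<close>], of "{}" t] by (simp add: containing_def)
  also have "(card D\<^sub>0 choose t) * (r * ?K) \<le> (r choose t) * (r * ?K)"
    using \<D>[OF \<open>D\<^sub>0 \<in> \<D>\<close>] by (intro mult_right_mono binomial_right_mono) auto
  finally show ?thesis
    by (simp add: mult.assoc)
qed

section \<open>Families with several set sizes\<close>

lemma card_eq_sum_levels:
  assumes "finite X" "finite S" "C \<subseteq> (\<Union>s\<in>S. nsets X s)"
  shows "card C = (\<Sum>s\<in>S. card (C \<inter> nsets X s))"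
proof -
  have "C = (\<Union>s\<in>S. C \<inter> nsets X s)"
    using assms(3) by blast
  also have "card \<dots> = (\<Sum>s\<in>S. card (C \<inter> nsets X s))"
    using assms(1,2) by (intro card_UN_disjoint) (auto simp: nsets_def finite_imp_finite_nsets)
  finally show ?thesis .
qed

lemma card_levels:
  assumes "finite X" "finite S"
  shows "card (\<Union>s\<in>S. nsets X s) = (\<Sum>s\<in>S. card X choose s)"
proof -
  have "card (\<Union>s\<in>S. nsets X s) = (\<Sum>s\<in>S. card ((\<Union>s\<in>S. nsets X s) \<inter> nsets X s))"
    using assms by (intro card_eq_sum_levels) auto
  also have "\<dots> = (\<Sum>s\<in>S. card X choose s)"
  proof (rule sum.cong)
    fix s assume "s \<in> S"
    then have "(\<Union>s\<in>S. nsets X s) \<inter> nsets X s = containing (nsets X s) {}"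
      by (auto simp: containing_def)
    then show "card ((\<Union>s\<in>S. nsets X s) \<inter> nsets X s) = card X choose s"
      using card_containing_nsets[OF assms(1), of "{}" s] by simp
  qed simp
  finally show ?thesis .
qed

lemma card_star_levels:
  assumes "finite X" "finite S" "T \<in> nsets X t" "\<And>s. s \<in> S \<Longrightarrow> t \<le> s"
  shows "card (containing (\<Union>s\<in>S. nsets X s) T) = (\<Sum>s\<in>S. (card X - t) choose (s - t))"
proof -
  have "card (containing (\<Union>s\<in>S. nsets X s) T)
      = (\<Sum>s\<in>S. card (containing (\<Union>s\<in>S. nsets X s) T \<inter> nsets X s))"
    using assms by (intro card_eq_sum_levels) (auto simp: containing_def)
  also have "\<dots> = (\<Sum>s\<in>S. (card X - t) choose (s - t))"
  proof (rule sum.cong)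
    fix s assume "s \<in> S"
    then have "containing (\<Union>s\<in>S. nsets X s) T \<inter> nsets X s = containing (nsets X s) T"
      by (auto simp: containing_def)
    then show "card (containing (\<Union>s\<in>S. nsets X s) T \<inter> nsets X s) = (card X - t) choose (s - t)"
      using card_containing_nsets[OF assms(1), of T s] assms(3,4) \<open>s \<in> S\<close> by (simp add: nsets_def)
  qed simp
  finally show ?thesis .
qed

text \<open>Ratio estimates are available for one set size at a time; they add up because
  \<open>a\<close> and \<open>b\<close> do not depend on \<open>s\<close>.\<close>

lemma levels_weighted_bound:
  fixes a b :: nat
  assumes "finite X" "finite S" "C \<subseteq> (\<Union>s\<in>S. nsets X s)"
    and "\<And>s. s \<in> S \<Longrightarrow> a * card (C \<inter> nsets X s) \<le> b * g s"
  shows "a * card C \<le> b * (\<Sum>s\<in>S. g s)"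
  unfolding card_eq_sum_levels[OF assms(1-3)] sum_distrib_left
  using assms(4) by (rule sum_mono)

section \<open>Numerical consequences of the threshold\<close>

text \<open>The comparison is with \<open>(2 * r) choose 2 = r * (2 * r - 1)\<close>. For
  \<open>t < r\<close> binomials increase from 2 up to \<open>t + 1\<close>. For
  \<open>t = r\<close> the index \<open>r + 1\<close> is past the middle and is reflected to
  \<open>r - 1\<close>, which is at least 2 once \<open>r \<ge> 3\<close>; for \<open>r = 1\<close>
  and \<open>r = 2\<close> equality holds.\<close>

lemma square_le_double_choose:
  assumes "1 \<le> t" "t \<le> r"
  shows "r * r \<le> (2 * r) choose (t + 1)"
proof -
  have two: "r * r \<le> (2 * r) choose 2" if "1 \<le> r"
    using that by (simp add: choose_two mult.assoc)
  consider "t < r" | "t = r" "r \<ge> 3" | "t = r" "r = 1" | "t = r" "r = 2"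
    using assms by linarith
  then show ?thesis
  proof cases
    case 1
    then show ?thesis
      using assms two binomial_mono[of 2 "t + 1" "2 * r"] by simp
  next
    case 2
    have "(2 * r) choose (r + 1) = (2 * r) choose (r - 1)"
      using binomial_symmetric[of "r + 1" "2 * r"] 2 by (simp add: numeral_2_eq_2)
    moreover have "(2 * r) choose 2 \<le> (2 * r) choose (r - 1)"
      using 2 by (intro binomial_mono) linarith+
    ultimately show ?thesis
      using 2 two by simp
  qed (simp_all add: eval_nat_numeral)
qed

text \<open>The left side is a single term of Vandermonde's sum: split a \<open>2 * r\<close>-set
  into halves and take \<open>t\<close> points from one and a single point from the other.\<close>

lemma choose_mult_le_double_choose:
  "(r choose t) * r \<le> (2 * r) choose (t + 1)"
proof -
  have "(r choose t) * (r choose (t + 1 - t)) \<le> (\<Sum>k\<le>t + 1. (r choose k) * (r choose (t + 1 - k)))"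
    by (rule member_le_sum) auto
  then show ?thesis
    by (simp add: vandermonde flip: mult_2)
qed

text \<open>Links the threshold to the binomial of the two preceding lemmas, since
  \<open>2 * r\<close> is a term of the maximum in \<open>m_const\<close>.\<close>

lemma double_choose_le_n_S:
  "(r - t + 1) * ((2 * r) choose (t + 1)) + r \<le> n_S r t"
  unfolding n_S_def m_const_def
  by (intro add_right_mono mult_left_mono binomial_right_mono) auto

section \<open>Uniqueness of the centre of cross-intersecting full stars\<close>

text \<open>Distinct centres could be extended by disjoint sets of points outside
  \<open>T \<union> T'\<close>, giving members that meet only in \<open>T \<inter> T'\<close>, which
  has fewer than \<open>t\<close> points. The bound on \<open>s + s'\<close> leaves room for both
  extensions.\<close>

lemma full_stars_same_centre:
  assumes "finite X" "T \<in> nsets X t" "T' \<in> nsets X t"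
    and "s \<in> S" "t \<le> s" "s' \<in> S'" "t \<le> s'" "s + s' \<le> card X"
    and cross: "\<And>A B. A \<in> containing (\<Union>s\<in>S. nsets X s) T \<Longrightarrow>
      B \<in> containing (\<Union>s\<in>S'. nsets X s) T' \<Longrightarrow> t_intersects t A B"
  shows "T = T'"
proof (rule ccontr)
  assume neq: "T \<noteq> T'"
  have T: "T \<subseteq> X" "finite T" "card T = t" and T': "T' \<subseteq> X" "finite T'" "card T' = t"
    using assms(2,3) by (auto simp: nsets_def)
  have "card (T \<union> T') \<le> 2 * t"
    using card_Un_le[of T T'] T T' by simp
  then have "s - t + (s' - t) \<le> card (X - (T \<union> T'))"
    using assms(1,5,7,8) T T' by (simp add: card_Diff_subset)
  then obtain Z where Z: "Z \<subseteq> X - (T \<union> T')" "card Z = s - t + (s' - t)" "finite Z"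
    by (rule obtain_subset_with_card_n)
  then obtain P where P: "P \<subseteq> Z" "card P = s - t" "finite P"
    by (metis le_add1 obtain_subset_with_card_n)
  have "card (T \<union> P) = s"
    using T P Z assms(5) by (subst card_Un_disjoint) auto
  then have A: "T \<union> P \<in> containing (\<Union>s\<in>S. nsets X s) T"
    using T P Z assms(4) by (auto simp: containing_def nsets_def)
  have "card (T' \<union> (Z - P)) = s'"
    using T' P Z assms(7) by (subst card_Un_disjoint) (auto simp: card_Diff_subset)
  then have B: "T' \<union> (Z - P) \<in> containing (\<Union>s\<in>S'. nsets X s) T'"
    using T' P Z assms(6) by (auto simp: containing_def nsets_def)
  have "(T \<union> P) \<inter> (T' \<union> (Z - P)) = T \<inter> T'"
    using P Z by blast
  moreover have "\<not> T \<subseteq> T'"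
    using neq T T' card_subset_eq[of T' T] by auto
  then have "card (T \<inter> T') < card T"
    using T(2) by (intro psubset_card_mono) auto
  ultimately have "card ((T \<union> P) \<inter> (T' \<union> (Z - P))) < t"
    using T(3) by simp
  then show False
    using cross[OF A B] by (simp add: t_intersects_def)
qed

section \<open>The bound and its extremal configurations\<close>

theorem theorem2p10:
  fixes t r n k :: nat
    and S :: "nat \<Rightarrow> nat set"
    and \<F> \<A> :: "nat \<Rightarrow> nat set set"
  assumes "1 \<le> t" and "t \<le> r" and "n \<ge> n_S r t" and "k \<ge> 2"
    and "\<And>i. i \<in> {1..k} \<Longrightarrow> S i \<noteq> {} \<and> S i \<subseteq> {t..r}"
    and "\<And>i. i \<in> {1..k} \<Longrightarrow> \<F> i = (\<Union>s\<in>S i. nsets {1..n} s)"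
    and "cross_t_intersecting t k \<A>"
    and "\<And>i. i \<in> {1..k} \<Longrightarrow> \<A> i \<subseteq> \<F> i"
  shows "(\<Sum>i=1..k. card (\<A> i)) \<le>
           Max (insert (\<Sum>i=1..k. \<Sum>s\<in>S i. (n - t) choose (s - t))
                       ((\<lambda>i. \<Sum>s\<in>S i. n choose s) ` {1..k}))
       \<and> ((\<Sum>i=1..k. card (\<A> i)) =
           Max (insert (\<Sum>i=1..k. \<Sum>s\<in>S i. (n - t) choose (s - t))
                       ((\<lambda>i. \<Sum>s\<in>S i. n choose s) ` {1..k}))
         \<longleftrightarrow>
           ((\<Sum>i=1..k. \<Sum>s\<in>S i. (n - t) choose (s - t)) >
              Max ((\<lambda>i. \<Sum>s\<in>S i. n choose s) ` {1..k})
            \<and> star_config n t k \<F> \<A>)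
         \<or> ((\<Sum>i=1..k. \<Sum>s\<in>S i. (n - t) choose (s - t)) <
              Max ((\<lambda>i. \<Sum>s\<in>S i. n choose s) ` {1..k})
            \<and> full_config k \<F> \<A>)
         \<or> ((\<Sum>i=1..k. \<Sum>s\<in>S i. (n - t) choose (s - t)) =
              Max ((\<lambda>i. \<Sum>s\<in>S i. n choose s) ` {1..k})
            \<and> (star_config n t k \<F> \<A> \<or> full_config k \<F> \<A>)))"
proof -
  let ?X = "{1..n}" and ?I = "{1..k}"
  let ?c = "r - t"
  define f where "f i = (\<Sum>s\<in>S i. n choose s)" for i
  define g where "g i = (\<Sum>s\<in>S i. (n - t) choose (s - t))" for i
  define M where "M = Max (f ` ?I)"
  note S = assms(5) and F = assms(6) and sub = assms(8)
  have finS: "finite (S i)" if "i \<in> ?I" for i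
    using S[OF that] finite_subset by blast
  have cardF: "card (\<F> i) = f i" if "i \<in> ?I" for i
    unfolding F[OF that] f_def using finS[OF that] by (simp add: card_levels)
  have finF: "finite (\<F> i)" if "i \<in> ?I" for i
    unfolding F[OF that] using finS[OF that] by (auto intro: finite_imp_finite_nsets)
  have card_star: "card (containing (\<F> i) T) = g i" if "i \<in> ?I" "T \<in> nsets ?X t" for i T
    unfolding F[OF that(1)] g_def
    using card_star_levels[of ?X "S i" T t] finS[OF that(1)] that(2) S[OF that(1)] by fastforce
  have card_le_f: "card (\<A> i) \<le> f i" if "i \<in> ?I" for i
    using card_mono[OF finF sub] cardF that by metis
  have f_le_M: "f i \<le> M" if "i \<in> ?I" for i
    using that by (simp add: M_def)
  have MaxF: "Max ((\<lambda>i. card (\<F> i)) ` ?I) = M"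
    unfolding M_def by (intro arg_cong[where f = Max] image_cong) (auto simp: cardF)
  have cross: "t_intersects t A B"
    if "i \<in> ?I" "j \<in> ?I" "i \<noteq> j" "A \<in> \<A> i" "B \<in> \<A> j" for i j A B
    using assms(7) that unfolding cross_t_intersecting_def by blast
  have memberD: "A \<subseteq> ?X \<and> finite A \<and> card A \<le> r" if "i \<in> ?I" "A \<in> \<A> i" for i A
    using sub[OF that(1)] that(2) S[OF that(1)] unfolding F[OF that(1)]
    by (fastforce simp: nsets_def)

  \<comment> \<open>This bound serves the family outside every star, \<open>n_choose\<close> the
    remaining families. The summand \<open>r\<close> makes the first comparison strict and absorbs
    the \<open>t\<close> of \<open>n - t\<close> in the second.\<close>
  have n_square: "(?c + 1) * (r * r) + r \<le> n"
    using square_le_double_choose[OF assms(1,2)] double_choose_le_n_S[of r t] assms(3)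
    by (meson add_le_mono1 le_trans mult_le_mono2)
  have n_choose: "(?c + 1) * ((r choose t) * r) + r \<le> n"
    using choose_mult_le_double_choose[of r t] double_choose_le_n_S[of r t] assms(3)
    by (meson add_le_mono1 le_trans mult_le_mono2)
  have r: "1 \<le> r"
    using assms by simp
  have "r * 1 \<le> (?c + 1) * (r * r)"
    using r mult_le_mono[of 1 "?c + 1" "r * 1" "r * r"] by simp
  then have n2r: "2 * r \<le> n"
    using n_square by linarith

  have star_sum: "(\<Sum>i\<in>?I. card (\<A> i)) = (\<Sum>i\<in>?I. g i)" if "star_config n t k \<F> \<A>"
    using that card_star unfolding star_config_def by (intro sum.cong) auto
  have full_sum: "(\<Sum>i\<in>?I. card (\<A> i)) = M" if full: "full_config k \<F> \<A>"
  proof -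
    obtain j where j: "j \<in> ?I" "card (\<F> j) = M" "\<A> j = \<F> j" "\<forall>i\<in>?I - {j}. \<A> i = {}"
      using full MaxF unfolding full_config_def by auto
    have "(\<Sum>i\<in>?I. card (\<A> i)) = card (\<A> j) + (\<Sum>i\<in>?I - {j}. card (\<A> i))"
      using j(1) by (intro sum.remove) auto
    then show ?thesis
      using j by simp
  qed

  \<comment> \<open>Equality need only yield one of the two configurations. Their sums are known
    from \<open>star_sum\<close> and \<open>full_sum\<close>, so comparing the star sum with
    \<open>M\<close> then decides which of them can attain the maximum.\<close>
  have key: "(\<Sum>i\<in>?I. card (\<A> i)) \<le> max (\<Sum>i\<in>?I. g i) M \<and>
    ((\<Sum>i\<in>?I. card (\<A> i)) = max (\<Sum>i\<in>?I. g i) M \<longrightarrow>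
      star_config n t k \<F> \<A> \<or> full_config k \<F> \<A>)"
  proof (cases "\<exists>j\<in>?I. \<forall>i\<in>?I - {j}. \<A> i = {}")
    case True
    then obtain j where j: "j \<in> ?I" "\<And>i. i \<in> ?I - {j} \<Longrightarrow> \<A> i = {}"
      by blast
    have "(\<Sum>i\<in>?I. card (\<A> i)) = card (\<A> j) + (\<Sum>i\<in>?I - {j}. card (\<A> i))"
      using j(1) by (intro sum.remove) auto
    then have sum: "(\<Sum>i\<in>?I. card (\<A> i)) = card (\<A> j)"
      using j by simp
    have "full_config k \<F> \<A>" if "card (\<A> j) \<ge> M"
    proof -
      have "card (\<A> j) = card (\<F> j)" "card (\<F> j) = M"
        using that card_le_f[OF j(1)] f_le_M[OF j(1)] cardF[OF j(1)] by auto
      moreover from this have "\<A> j = \<F> j"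
        using card_subset_eq[OF finF sub] j(1) by blast
      ultimately show ?thesis
        unfolding full_config_def MaxF using j by auto
    qed
    then show ?thesis
      using sum card_le_f[OF j(1)] f_le_M[OF j(1)] by auto
  next
    case two: False
    show ?thesis
    proof (cases "\<exists>i\<in>?I. \<forall>T\<in>nsets ?X t. \<exists>A\<in>\<A> i. \<not> T \<subseteq> A")
      case True
      then obtain i where i: "i \<in> ?I" and nontriv: "\<And>T. T \<in> nsets ?X t \<Longrightarrow> \<exists>A\<in>\<A> i. \<not> T \<subseteq> A"
        by blast
      \<comment> \<open>Any \<open>t\<close>-subset would do: \<open>nontriv\<close> applied to it
        shows that \<open>\<A> i\<close> is nonempty.\<close>
      have "{1..t} \<in> nsets ?X t"
        using n2r assms(2) by (auto simp: nsets_def)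
      then obtain D where D: "D \<in> \<A> i"
        using nontriv by blast
      obtain j B where j: "j \<in> ?I" "j \<noteq> i" and B: "B \<in> \<A> j"
        using two i by blast
      \<comment> \<open>\<open>?K\<close> bounds the number of pairs \<open>(T, x)\<close>. Each
        pair accounts for at most the fraction \<open>?c / (n - t)\<close> of the star, and
        \<open>n - t\<close> is at least \<open>(?c + 1) * ?K\<close>.\<close>
      have small: "(?c + 1) * card (\<A> j) \<le> ?c * g j" if j: "j \<in> ?I" "j \<noteq> i" for j
      proof -
        let ?K = "(r choose t) * r"
        have "(n - t) * card (\<A> j) \<le> (?K * ?c) * g j"
          unfolding g_def
        proof (rule levels_weighted_bound[OF _ finS[OF j(1)]])
          show "\<A> j \<subseteq> (\<Union>s\<in>S j. nsets ?X s)"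
            using sub[OF j(1)] F[OF j(1)] by simp
          fix s assume s: "s \<in> S j"
          then have "s \<in> {t..r}"
            using S[OF j(1)] by blast
          then have st: "t \<le> s" "s - t \<le> ?c"
            by auto
          have "(card ?X - t) * card (\<A> j \<inter> nsets ?X s)
              \<le> ?K * ((s - t) * ((card ?X - t) choose (s - t)))"
          proof (rule card_cross_nontrivial_le)
            show "finite ?X" by simp
            show "A \<subseteq> ?X \<and> card A \<le> r" if "A \<in> \<A> i" for A
              using memberD[OF i that] by blast
            show "t_intersects t A B" if "A \<in> \<A> i" "B \<in> \<A> j \<inter> nsets ?X s" for A B
              using cross[OF i j(1)] j(2) that by auto
          qed (use nontriv D st in auto)
          also have "\<dots> \<le> ?K * (?c * ((card ?X - t) choose (s - t)))"
            using st by (intro mult_left_mono mult_right_mono) auto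
          finally show "(n - t) * card (\<A> j \<inter> nsets ?X s) \<le> (?K * ?c) * ((n - t) choose (s - t))"
            by (simp add: mult.assoc)
        qed simp
        moreover have "(?c + 1) * ?K \<le> n - t"
          using n_choose assms(2) by linarith
        ultimately have "((?c + 1) * ?K) * card (\<A> j) \<le> (?K * ?c) * g j"
          by (meson le_trans mult_le_mono1)
        then have "?K * ((?c + 1) * card (\<A> j)) \<le> ?K * (?c * g j)"
          by (simp only: ac_simps)
        moreover have "?K > 0"
          using assms(2) r by simp
        ultimately show ?thesis
          using nat_mult_le_cancel1 by blast
      qed
      \<comment> \<open>As \<open>t \<ge> 1\<close>, all members of \<open>\<A> i\<close> meet
        \<open>B\<close>, which has at most \<open>r\<close> points; each point lies in at most the
        fraction \<open>r / n\<close> of a level.\<close>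
      have "n * card (\<A> i) \<le> (r * r) * f i"
        unfolding f_def
      proof (rule levels_weighted_bound[OF _ finS[OF i]])
        show "\<A> i \<subseteq> (\<Union>s\<in>S i. nsets ?X s)"
          using sub[OF i] F[OF i] by simp
        fix s assume s: "s \<in> S i"
        have "card ?X * card (\<A> i \<inter> nsets ?X s) \<le> card B * (s * (card ?X choose s))"
        proof (rule card_meeting_le)
          show "finite B"
            using memberD[OF j(1) B] by blast
          show "A \<inter> B \<noteq> {}" if "A \<in> \<A> i \<inter> nsets ?X s" for A
            using cross[OF i j(1) _ _ B, of A] j(2) that assms(1) by (auto simp: t_intersects_def)
        qed auto
        also have "\<dots> \<le> r * (r * (card ?X choose s))"
          using memberD[OF j(1) B] s S[OF i] by (intro mult_mono) auto
        finally show "n * card (\<A> i \<inter> nsets ?X s) \<le> (r * r) * (n choose s)"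
          by (simp add: mult.assoc)
      qed simp
      moreover have "card (\<A> i) > 0"
        using D finite_subset[OF sub[OF i] finF[OF i]] by (auto simp: card_gt_0_iff)
      moreover have "(?c + 1) * (r * r) < n"
        using n_square r by linarith
      ultimately have "((?c + 1) * (r * r)) * card (\<A> i) < (r * r) * f i"
        by (meson le_trans less_le_trans mult_less_mono1)
      then have "(r * r) * ((?c + 1) * card (\<A> i)) < (r * r) * f i"
        by (simp only: ac_simps)
      then have large: "(?c + 1) * card (\<A> i) < f i"
        by simp
      have "(\<Sum>j\<in>?I. card (\<A> j)) = card (\<A> i) + (\<Sum>j\<in>?I - {i}. card (\<A> j))"
        using i by (intro sum.remove) auto
      \<comment> \<open>After scaling by \<open>?c + 1\<close>, \<open>f i\<close> enters with
        weight 1 and the star sum with weight \<open>?c\<close>; both are at most the maximum.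
        Strictness in \<open>large\<close> excludes equality in this case.\<close>
      then have "(?c + 1) * (\<Sum>j\<in>?I. card (\<A> j))
          = (?c + 1) * card (\<A> i) + (\<Sum>j\<in>?I - {i}. (?c + 1) * card (\<A> j))"
        by (simp only: distrib_left sum_distrib_left)
      also have "\<dots> < f i + (\<Sum>j\<in>?I - {i}. ?c * g j)"
        using large small by (intro add_less_le_mono sum_mono) auto
      also have "(\<Sum>j\<in>?I - {i}. ?c * g j) \<le> ?c * (\<Sum>j\<in>?I. g j)"
        unfolding sum_distrib_left by (rule sum_mono2) auto
      also have "f i + ?c * (\<Sum>j\<in>?I. g j) \<le> max (\<Sum>j\<in>?I. g j) M + ?c * max (\<Sum>j\<in>?I. g j) M"
        using f_le_M[OF i] by (intro add_mono mult_left_mono) auto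
      finally have "(?c + 1) * (\<Sum>j\<in>?I. card (\<A> j)) < (?c + 1) * max (\<Sum>j\<in>?I. g j) M"
        by simp
      then have "(\<Sum>j\<in>?I. card (\<A> j)) < max (\<Sum>j\<in>?I. g j) M"
        by (simp only: mult_less_cancel1)
      then show ?thesis
        by simp
    next
      case False
      \<comment> \<open>The centres may still depend on \<open>i\<close>; for an empty family
        \<open>T i\<close> is arbitrary.\<close>
      then obtain T where T: "\<And>i. i \<in> ?I \<Longrightarrow> T i \<in> nsets ?X t"
        and TA: "\<And>i A. i \<in> ?I \<Longrightarrow> A \<in> \<A> i \<Longrightarrow> T i \<subseteq> A"
        by metis
      have subT: "\<A> i \<subseteq> containing (\<F> i) (T i)" if "i \<in> ?I" for i
        using TA[OF that] sub[OF that] by (auto simp: containing_def)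
      have card_le_g: "card (\<A> i) \<le> g i" if "i \<in> ?I" for i
        using card_mono[OF _ subT[OF that]] finF[OF that] card_star[OF that T[OF that]] by simp
      then have le: "(\<Sum>i\<in>?I. card (\<A> i)) \<le> (\<Sum>i\<in>?I. g i)"
        by (rule sum_mono)
      have "star_config n t k \<F> \<A>" if eq: "(\<Sum>i\<in>?I. card (\<A> i)) = (\<Sum>i\<in>?I. g i)"
      proof -
        have AT: "\<A> i = containing (\<F> i) (T i)" if i: "i \<in> ?I" for i
        proof (rule card_subset_eq)
          show "card (\<A> i) = card (containing (\<F> i) (T i))"
            \<comment> \<open>Termwise inequalities with equal finite sums are termwise
              equalities.\<close>
            unfolding card_star[OF i T[OF i]] by (rule sum_mono_inv[OF eq card_le_g i]) auto
        qed (use finF i subT in auto)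
        \<comment> \<open>The cross condition concerns distinct indices only, so each other centre
          is compared with that of index 1.\<close>
        have "T i = T 1" if i: "i \<in> ?I" for i
        proof (cases "i = 1")
          case False
          have 1: "1 \<in> ?I"
            using assms(4) by simp
          obtain s s' where s: "s \<in> S i" "s' \<in> S 1"
            using S[OF i] S[OF 1] by blast
          then have b: "t \<le> s" "s \<le> r" "t \<le> s'" "s' \<le> r"
            using S[OF i] S[OF 1] by auto
          show ?thesis
          proof (rule full_stars_same_centre[OF _ T[OF i] T[OF 1] s(1) b(1) s(2) b(3)])
            show "s + s' \<le> card ?X"
              using b n2r by simp
            show "t_intersects t A B"
              if "A \<in> containing (\<Union>s\<in>S i. nsets ?X s) (T i)"
                "B \<in> containing (\<Union>s\<in>S 1. nsets ?X s) (T 1)" for A B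
              using cross[OF i 1 False] that AT[OF i] AT[OF 1] F[OF i] F[OF 1] by simp
          qed simp
        qed simp
        then have "\<forall>i\<in>?I. \<A> i = containing (\<F> i) (T 1)"
          using AT by metis
        moreover have "T 1 \<in> nsets ?X t"
          using T[of 1] assms(4) by simp
        ultimately show ?thesis
          unfolding star_config_def by blast
      qed
      then show ?thesis
        using le by auto
    qed
  qed
  have "Max (insert (\<Sum>i\<in>?I. g i) (f ` ?I)) = max (\<Sum>i\<in>?I. g i) M"
    unfolding M_def using assms(4) by (intro Max_insert) auto
  then show ?thesis
    using key star_sum full_sum unfolding f_def g_def M_def by linarith
qed

end
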